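(* Let $r>0$ and let $k,l$ be positive integers. Let $S(r)=\sum_{m=1}^{\infty}\frac{2m}{(m^2+r^2)^2}$. Define $a_1=1$, $b_1=\left(k-\frac12\right)^2-\frac14+r^2$, and for $n\ge1$ $$a_{2n}=\frac{n^3}{2(2n-1)},\quad a_{2n+1}=\frac{n\left(n^2+4r^2\right)}{2(2n+1)},\quad b_{2n}=1,\quad b_{2n+1}=\left(k-\tfrac12\right)^2-\tfrac14+\frac{r^2}{2n+1}.$$ Then $$\sum_{m=1}^{k-1}\frac{2m}{\left(m^2+r^2\right)^2}+\mathbf{K}_{n=1}^{2l}\left(\frac{a_n}{b_n}\right)<S(r)<\sum_{m=1}^{k-1}\frac{2m}{\left(m^2+r^2\right)^2}+\mathbf{K}_{n=1}^{2l-1}\left(\frac{a_n}{b_n}\right).$$ In particular, for all $r>0$, $$\frac{2}{(1+r^2)^2}+\frac{1}{\frac52+r^2}<S(r)<\frac{2}{(1+r^2)^2}+\frac{1}{2+r^2},$$ $$\frac{2}{(1+r^2)^2}+\frac{4}{(4+r^2)^2}+\frac{1}{\frac{13}{2}+r^2}<S(r)<\frac{2}{(1+r^2)^2}+\frac{4}{(4+r^2)^2}+\frac{1}{6+r^2}.$$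
   Context: For a positive integer $N$, $\mathbf{K}_{n=1}^{N}\left(\frac{a_n}{b_n}\right)$ denotes the finite continued fraction $\cfrac{a_1}{b_1+\cfrac{a_2}{b_2+\cdots+\cfrac{a_N}{b_N}}}$. For $k=1$ the sum $\sum_{m=1}^{k-1}$ is empty and equals zero. *)

theory Defs
  imports "HOL-Analysis.Analysis"
begin

text \<open>\<open>cfrac_from a b i N\<close> is the finite continued fraction with \<open>N\<close> levels that starts at index \<open>i\<close>:
  \<open>a i / (b i + a (i+1) / (b (i+1) + ... + a (i+N-1) / b (i+N-1)))\<close>.\<close>

primrec cfrac_from :: "(nat \<Rightarrow> real) \<Rightarrow> (nat \<Rightarrow> real) \<Rightarrow> nat \<Rightarrow> nat \<Rightarrow> real" where
  "cfrac_from a b i 0 = 0"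
| "cfrac_from a b i (Suc N) = a i / (b i + cfrac_from a b (Suc i) N)"

definition cfrac :: "(nat \<Rightarrow> real) \<Rightarrow> (nat \<Rightarrow> real) \<Rightarrow> nat \<Rightarrow> real" where
  "cfrac a b N = cfrac_from a b 1 N"

lemma cfrac_3: "cfrac a b 3 = a 1 / (b 1 + a 2 / (b 2 + a 3 / b 3))"
  by (simp add: cfrac_def numeral_3_eq_3 numeral_2_eq_2)

definition mathieu_series :: "real \<Rightarrow> real" where
  "mathieu_series r = (\<Sum>m. 2 * real (Suc m) / ((real (Suc m))\<^sup>2 + r\<^sup>2)\<^sup>2)"

lemma summable_mathieu_series:
  "summable (\<lambda>m. 2 * real (Suc m) / ((real (Suc m))\<^sup>2 + r\<^sup>2)\<^sup>2)"
proof (rule summable_comparison_test)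
  have "summable (\<lambda>m. inverse (real (Suc m) ^ 2))"
    by (subst summable_Suc_iff) (rule inverse_power_summable; simp)
  then show "summable (\<lambda>m. 2 * inverse (real (Suc m) ^ 2))"
    by (rule summable_mult)
  show "\<exists>N. \<forall>n\<ge>N. norm (2 * real (Suc n) / ((real (Suc n))\<^sup>2 + r\<^sup>2)\<^sup>2)
      \<le> 2 * inverse (real (Suc n) ^ 2)"
  proof (intro exI allI impI)
    fix n :: nat
    define x where "x = real (Suc n)"
    have x: "x \<ge> 1" by (simp add: x_def)
    have "(x\<^sup>2)\<^sup>2 \<le> (x\<^sup>2 + r\<^sup>2)\<^sup>2"
      by (rule power_mono) auto
    then have "2 * x / (x\<^sup>2 + r\<^sup>2)\<^sup>2 \<le> 2 * x / (x\<^sup>2)\<^sup>2"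
      using x by (intro divide_left_mono) (auto simp: add_pos_nonneg)
    also have "\<dots> = 2 * inverse (x\<^sup>2) * (1 / x)"
      using x by (simp add: field_simps power2_eq_square)
    also have "\<dots> \<le> 2 * inverse (x\<^sup>2) * 1"
      using x by (intro mult_left_mono) auto
    finally show "norm (2 * real (Suc n) / ((real (Suc n))\<^sup>2 + r\<^sup>2)\<^sup>2)
        \<le> 2 * inverse (real (Suc n) ^ 2)"
      using x by (simp add: x_def)
  qed
qed

text \<open>The partial numerators and denominators are only meant for positive indices;
  their values at index \<open>0\<close> are irrelevant.\<close>

definition mathieu_a :: "real \<Rightarrow> nat \<Rightarrow> real" where
  "mathieu_a r j =
    (let n = real (j div 2) in
     if j = 1 then 1
     else if even j then n ^ 3 / (2 * (2 * n - 1))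
     else n * (n\<^sup>2 + 4 * r\<^sup>2) / (2 * (2 * n + 1)))"

definition mathieu_b :: "real \<Rightarrow> nat \<Rightarrow> nat \<Rightarrow> real" where
  "mathieu_b r k j =
    (let n = real (j div 2) in
     if j = 1 then (real k - 1/2)\<^sup>2 - 1/4 + r\<^sup>2
     else if even j then 1
     else (real k - 1/2)\<^sup>2 - 1/4 + r\<^sup>2 / (2 * n + 1))"

lemma mathieu_a_1: "mathieu_a r 1 = 1"
  and mathieu_a_even:
    "n \<ge> 1 \<Longrightarrow> mathieu_a r (2 * n) = real n ^ 3 / (2 * (2 * real n - 1))"
  and mathieu_a_odd:
    "n \<ge> 1 \<Longrightarrow> mathieu_a r (2 * n + 1) =
      real n * ((real n)\<^sup>2 + 4 * r\<^sup>2) / (2 * (2 * real n + 1))"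
  by (simp_all add: mathieu_a_def Let_def)

lemma mathieu_b_1: "mathieu_b r k 1 = (real k - 1/2)\<^sup>2 - 1/4 + r\<^sup>2"
  and mathieu_b_even: "n \<ge> 1 \<Longrightarrow> mathieu_b r k (2 * n) = 1"
  and mathieu_b_odd:
    "n \<ge> 1 \<Longrightarrow> mathieu_b r k (2 * n + 1) =
      (real k - 1/2)\<^sup>2 - 1/4 + r\<^sup>2 / (2 * real n + 1)"
  by (simp_all add: mathieu_b_def Let_def)

end

theory Submission
  imports Defs "HOL-Real_Asymp.Real_Asymp"
begin

text \<open>Write \<open>F k\<close> for a convergent of the continued fraction. If \<open>F k - F (k+1)\<close> exceeds the \<open>k\<close>-th
  term of the series for every \<open>k\<close>, then \<open>F k\<close> exceeds the tail of the series from \<open>k\<close> on, since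
  \<open>F k\<close> tends to \<open>0\<close>; the lower bounds are analogous. The telescoping equation
  \<open>f k - f (k+1) = 2 k / (k\<^sup>2 + r\<^sup>2)\<^sup>2\<close> is a bilinear equation in \<open>u = f k\<close> and \<open>v = f (k+1)\<close>.
  Substituting \<open>u = a / (b + u')\<close>, \<open>v = a / (b' + v')\<close> level by level, it stays bilinear, with
  coefficients of bounded degree in \<open>k\<close> and with a constant coefficient whose sign alternates.
  Truncating the fraction leaves exactly this constant coefficient, so the error of a convergent
  in the telescoping equation has the parity of its length.\<close>

section \<open>Bilinear forms of the telescoping equation\<close>

text \<open>The left side of the telescoping equation at \<open>x = k\<close> after
  \<open>2 * m\<close> substituted levels, up to a nonzero factor; \<open>u\<close> and
  \<open>v\<close> are the tails for \<open>k\<close> and \<open>k + 1\<close>. For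
  \<open>m = 0\<close> it is \<open>2 * x - (x^2 + r^2)^2 * (u - v)\<close>.\<close>

definition riccati_odd :: "real \<Rightarrow> nat \<Rightarrow> real \<Rightarrow> real \<Rightarrow> real \<Rightarrow> real" where
  "riccati_odd r m x u v =
     2 * (2 * real m + 1) * mathieu_a r (2 * m + 1) * x
     + (2 * real m * x * (r\<^sup>2 - x\<^sup>2) - ((x\<^sup>2 + r\<^sup>2)\<^sup>2 + 2 * (real m)\<^sup>2 * x\<^sup>2)) * u
     + (2 * real m * x * (r\<^sup>2 - x\<^sup>2) + ((x\<^sup>2 + r\<^sup>2)\<^sup>2 + 2 * (real m)\<^sup>2 * x\<^sup>2)) * v
     - 4 * real m * x ^ 3 * (u * v)"

text \<open>The counterpart after \<open>2 * m - 1\<close> levels, with tails starting at index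
  \<open>2 * m\<close>.\<close>

definition riccati_even :: "real \<Rightarrow> nat \<Rightarrow> real \<Rightarrow> real \<Rightarrow> real \<Rightarrow> real" where
  "riccati_even r m x u v =
     - 4 * real m * mathieu_a r (2 * m) * x ^ 3
     + (2 * real m * x * (x\<^sup>2 + r\<^sup>2) + ((x\<^sup>2 + r\<^sup>2)\<^sup>2 + 2 * (real m)\<^sup>2 * x\<^sup>2)) * u
     + (2 * real m * x * (x\<^sup>2 + r\<^sup>2) - ((x\<^sup>2 + r\<^sup>2)\<^sup>2 + 2 * (real m)\<^sup>2 * x\<^sup>2)) * v
     + 2 * (2 * real m - 1) * x * (u * v)"

text \<open>The constant term is taken as \<open>p * a\<close> so that \<open>a\<close> factors out;
  what remains is again bilinear in \<open>u\<close> and \<open>v\<close>, over the product of the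
  denominators.\<close>

lemma bilinear_moebius:
  fixes a p q s t b c u v :: real
  assumes "b + u \<noteq> 0" "c + v \<noteq> 0"
  shows "p * a + q * (a / (b + u)) + s * (a / (c + v)) + t * ((a / (b + u)) * (a / (c + v)))
    = a * ((p * b * c + q * c + s * b + t * a) + (p * c + s) * u + (p * b + q) * v
        + p * (u * v)) / ((b + u) * (c + v))"
  using assms by (simp add: divide_simps) (simp add: algebra_simps)

section \<open>Positivity of the coefficients and tails\<close>

lemma mathieu_a_pos:
  assumes "r \<noteq> 0" "j \<ge> 1"
  shows "mathieu_a r j > 0"
proof (cases "j = 1")
  case False
  with assms have n: "real (j div 2) \<ge> 1"
    by (simp add: div_le_mono[of 2 j 2, simplified])
  have "(real (j div 2))\<^sup>2 + 4 * r\<^sup>2 > 0"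
    using n by (intro add_pos_nonneg) auto
  with False n show ?thesis
    by (auto simp: mathieu_a_def Let_def)
qed (simp add: mathieu_a_def)

lemma mathieu_b_pos:
  assumes "r \<noteq> 0" "k \<ge> 1"
  shows "mathieu_b r k j > 0"
proof -
  have "(real k - 1/2)\<^sup>2 - 1/4 = real k * (real k - 1)"
    by (simp add: power2_eq_square field_simps)
  also have "\<dots> \<ge> 0"
    using assms by simp
  finally have "(real k - 1/2)\<^sup>2 - 1/4 \<ge> 0" .
  with assms show ?thesis
    by (auto simp: mathieu_b_def Let_def intro!: add_nonneg_pos)
qed

lemma cfrac_from_nonneg:
  assumes "\<And>j. j \<ge> i \<Longrightarrow> a j \<ge> 0" "\<And>j. j \<ge> i \<Longrightarrow> b j \<ge> 0"
  shows "cfrac_from a b i N \<ge> 0"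
  using assms by (induction N arbitrary: i) auto

text \<open>Together with \<open>mathieu_b_pos\<close> this makes every denominator positive, so
  substituting a level neither divides by zero nor flips a sign.\<close>

lemma mathieu_cfrac_from_nonneg:
  assumes "r \<noteq> 0" "k \<ge> 1" "i \<ge> 1"
  shows "cfrac_from (mathieu_a r) (mathieu_b r k) i N \<ge> 0"
  using mathieu_a_pos[of r] mathieu_b_pos[of r k] assms
  by (intro cfrac_from_nonneg) (auto intro: less_imp_le)

section \<open>Passing from one level of the fraction to the next\<close>

text \<open>Here \<open>b\<close> and \<open>c\<close> are the partial denominators for
  \<open>k = x\<close> and \<open>k = x + 1\<close>, since
  \<open>(k - 1/2)^2 - 1/4 = k * (k - 1)\<close>. The proof matches the constant coefficient and
  those of \<open>u\<close> and \<open>v\<close> in turn; that of \<open>u * v\<close> is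
  \<open>p\<close> on both sides.\<close>

lemma riccati_odd_step:
  fixes r x u v :: real and m :: nat
  defines "a \<equiv> mathieu_a r (2 * m + 1)"
  defines "b \<equiv> x\<^sup>2 - x + r\<^sup>2 / (2 * real m + 1)"
  defines "c \<equiv> x\<^sup>2 + x + r\<^sup>2 / (2 * real m + 1)"
  assumes "b + u \<noteq> 0" "c + v \<noteq> 0"
  shows "riccati_odd r m x (a / (b + u)) (a / (c + v))
    = a * riccati_even r (Suc m) x u v / ((b + u) * (c + v))"
proof -
  define p where "p = 2 * (2 * real m + 1) * x"
  define e where "e = (x\<^sup>2 + r\<^sup>2)\<^sup>2 + 2 * (real m)\<^sup>2 * x\<^sup>2"
  define h where "h = 2 * real m * x * (r\<^sup>2 - x\<^sup>2)"
  define e' where "e' = (x\<^sup>2 + r\<^sup>2)\<^sup>2 + 2 * (real (Suc m))\<^sup>2 * x\<^sup>2"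
  define h' where "h' = 2 * real (Suc m) * x * (x\<^sup>2 + r\<^sup>2)"
  define d where "d = r\<^sup>2 / (2 * real m + 1)"
  \<comment> \<open>Eliminating \<open>r\<close> in favour of \<open>d\<close> turns the coefficient
    identities into polynomial ones.\<close>
  have d: "r\<^sup>2 = d * (2 * real m + 1)"
    by (simp add: d_def)
  have bc: "b = x\<^sup>2 - x + d" "c = x\<^sup>2 + x + d"
    by (simp_all add: b_def c_def d_def)
  \<comment> \<open>The extra factor \<open>m\<close> covers \<open>m = 0\<close>, where the first
    numerator is 1 and does not follow the general formula.\<close>
  have ma: "real m * (2 * (2 * real m + 1) * a) = real m * (real m * ((real m)\<^sup>2 + 4 * r\<^sup>2))"
  proof (cases "m = 0")
    case False
    then have "2 * (2 * real m + 1) * a = real m * ((real m)\<^sup>2 + 4 * r\<^sup>2)"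
      unfolding a_def by (subst mathieu_a_odd) (simp_all add: field_simps)
    then show ?thesis by simp
  qed simp
  have a': "2 * (2 * real m + 1) * mathieu_a r (2 * Suc m) = real (Suc m) ^ 3"
    by (subst mathieu_a_even) (simp_all add: field_simps)
  \<comment> \<open>The factor \<open>2 * m + 1\<close> clears the denominators of both numerators;
    all powers of \<open>x\<close> other than the cube then cancel.\<close>
  have "(2 * real m + 1) * (p * b * c + (h - e) * c + (h + e) * b - 4 * real m * x ^ 3 * a)
      = (2 * real m + 1) * (p * b * c + (h - e) * c + (h + e) * b)
        - 2 * x ^ 3 * (real m * (2 * (2 * real m + 1) * a))"
    by (simp add: algebra_simps)
  also have "\<dots> = - 2 * real (Suc m) * real (Suc m) ^ 3 * x ^ 3"
    unfolding ma bc p_def h_def e_def d of_nat_Suc by algebra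
  also have "\<dots> = (2 * real m + 1) * (- 4 * real (Suc m) * mathieu_a r (2 * Suc m) * x ^ 3)"
    unfolding a'[symmetric] by (simp add: algebra_simps)
  finally have P: "p * b * c + (h - e) * c + (h + e) * b - 4 * real m * x ^ 3 * a
      = - 4 * real (Suc m) * mathieu_a r (2 * Suc m) * x ^ 3"
    by (subst (asm) mult_cancel_left) simp
  have Q: "p * c + (h + e) = h' + e'" and R: "p * b + (h - e) = h' - e'"
    unfolding bc p_def h_def e_def h'_def e'_def d of_nat_Suc by algebra+
  have "riccati_odd r m x (a / (b + u)) (a / (c + v))
      = p * a + (h - e) * (a / (b + u)) + (h + e) * (a / (c + v))
        + (- 4 * real m * x ^ 3) * ((a / (b + u)) * (a / (c + v)))"
    by (simp add: riccati_odd_def p_def h_def e_def a_def)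
  also have "\<dots> = a * (- 4 * real (Suc m) * mathieu_a r (2 * Suc m) * x ^ 3
      + (h' + e') * u + (h' - e') * v + p * (u * v)) / ((b + u) * (c + v))"
    using P Q R by (subst bilinear_moebius[OF assms(4,5)]) simp
  also have "\<dots> = a * riccati_even r (Suc m) x u v / ((b + u) * (c + v))"
    by (simp add: riccati_even_def p_def h'_def e'_def)
  finally show ?thesis .
qed

lemma riccati_even_step:
  fixes r x u v :: real and m :: nat
  defines "a \<equiv> mathieu_a r (2 * m)"
  assumes "m \<ge> 1" "1 + u \<noteq> 0" "1 + v \<noteq> 0"
  shows "riccati_even r m x (a / (1 + u)) (a / (1 + v))
    = a * riccati_odd r m x u v / ((1 + u) * (1 + v))"
proof -
  define p where "p = - 4 * real m * x ^ 3"
  define e where "e = (x\<^sup>2 + r\<^sup>2)\<^sup>2 + 2 * (real m)\<^sup>2 * x\<^sup>2"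
  define h where "h = 2 * real m * x * (x\<^sup>2 + r\<^sup>2)"
  define h' where "h' = 2 * real m * x * (r\<^sup>2 - x\<^sup>2)"
  have a: "2 * (2 * real m - 1) * a = real m ^ 3"
    using assms(2) by (simp add: a_def mathieu_a_even)
  have a': "2 * (2 * real m + 1) * mathieu_a r (2 * m + 1) = real m * ((real m)\<^sup>2 + 4 * r\<^sup>2)"
    using assms(2) by (subst mathieu_a_odd) (simp_all add: field_simps)
  \<comment> \<open>In the constant coefficient \<open>e\<close> cancels, and so do the cubes of
    \<open>x\<close> in \<open>p + 2 * h\<close>; the rest is
    \<open>m * x * (m^2 + 4 * r^2)\<close>, which contains the next numerator.\<close>
  have "p + (h + e) + (h - e) + 2 * (2 * real m - 1) * x * a = p + 2 * h + real m ^ 3 * x"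
    unfolding a[symmetric] by (simp add: algebra_simps)
  also have "\<dots> = 2 * (2 * real m + 1) * mathieu_a r (2 * m + 1) * x"
    unfolding a' p_def h_def by algebra
  finally have P: "p + (h + e) + (h - e) + 2 * (2 * real m - 1) * x * a
      = 2 * (2 * real m + 1) * mathieu_a r (2 * m + 1) * x" .
  have Q: "p + (h - e) = h' - e" and R: "p + (h + e) = h' + e"
    unfolding p_def h_def h'_def by algebra+
  have "riccati_even r m x (a / (1 + u)) (a / (1 + v))
      = p * a + (h + e) * (a / (1 + u)) + (h - e) * (a / (1 + v))
        + (2 * (2 * real m - 1) * x) * ((a / (1 + u)) * (a / (1 + v)))"
    by (simp add: riccati_even_def p_def h_def e_def a_def)
  also have "\<dots> = a * (2 * (2 * real m + 1) * mathieu_a r (2 * m + 1) * x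
      + (h' - e) * u + (h' + e) * v + p * (u * v)) / ((1 + u) * (1 + v))"
    unfolding P[symmetric] Q[symmetric] R[symmetric]
    by (subst bilinear_moebius[OF assms(3,4)]) simp
  also have "\<dots> = a * riccati_odd r m x u v / ((1 + u) * (1 + v))"
    by (simp add: riccati_odd_def p_def h'_def e_def)
  finally show ?thesis .
qed

text \<open>For \<open>N = 0\<close> both tails vanish and only the constant coefficient is left,
  positive in the odd form and negative in the even one. Each further level multiplies by a positive
  factor and exchanges the two forms, so both signs are proved in one induction.\<close>

lemma riccati_cfrac_sign:
  assumes "r \<noteq> 0" "k \<ge> 1"
  defines "f \<equiv> \<lambda>k. cfrac_from (mathieu_a r) (mathieu_b r k)"
  shows "(-1) ^ N * riccati_odd r m (real k) (f k (2 * m + 1) N) (f (Suc k) (2 * m + 1) N) > 0"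
    and "m \<ge> 1 \<Longrightarrow>
      (-1) ^ N * riccati_even r m (real k) (f k (2 * m) N) (f (Suc k) (2 * m) N) < 0"
proof (induction N arbitrary: m)
  case 0
  {
    case 1
    show ?case
      using assms mathieu_a_pos[of r "2 * m + 1"] by (simp add: riccati_odd_def)
  next
    case 2
    then show ?case
      using assms mathieu_a_pos[of r "2 * m"] by (simp add: riccati_even_def)
  }
next
  case (Suc N)
  have nonneg: "f k i N \<ge> 0" "f (Suc k) i N \<ge> 0" if "i \<ge> 1" for i
    using mathieu_cfrac_from_nonneg assms that by (simp_all add: f_def)
  {
    case 1
    let ?a = "mathieu_a r (2 * m + 1)"
    let ?b = "mathieu_b r k (2 * m + 1)" and ?c = "mathieu_b r (Suc k) (2 * m + 1)"
    let ?u = "f k (2 * Suc m) N" and ?v = "f (Suc k) (2 * Suc m) N"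
    have b: "?b = (real k)\<^sup>2 - real k + r\<^sup>2 / (2 * real m + 1)"
      and c: "?c = (real k)\<^sup>2 + real k + r\<^sup>2 / (2 * real m + 1)"
      by (auto simp: mathieu_b_def Let_def power2_eq_square algebra_simps)
    have pos: "?a > 0" "?b + ?u > 0" "?c + ?v > 0"
      using mathieu_a_pos mathieu_b_pos nonneg assms by (simp_all add: add_pos_nonneg)
    have "riccati_odd r m (real k) (f k (2 * m + 1) (Suc N)) (f (Suc k) (2 * m + 1) (Suc N))
        = ?a * riccati_even r (Suc m) (real k) ?u ?v / ((?b + ?u) * (?c + ?v))"
      using riccati_odd_step[of "real k" r m ?u ?v, folded b c] pos
      by (simp add: f_def)
    \<comment> \<open>The inserted minus sign makes the negative even form positive; it is the
      factor by which \<open>(-1) ^ Suc N\<close> differs from \<open>(-1) ^ N\<close>.\<close>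
    moreover have "?a * - ((-1) ^ N * riccati_even r (Suc m) (real k) ?u ?v)
        / ((?b + ?u) * (?c + ?v)) > 0"
      using pos Suc(2)[of "Suc m"] by (intro divide_pos_pos mult_pos_pos) auto
    ultimately show ?case
      by (simp add: algebra_simps)
  next
    case 2
    let ?a = "mathieu_a r (2 * m)"
    let ?u = "f k (2 * m + 1) N" and ?v = "f (Suc k) (2 * m + 1) N"
    have b: "mathieu_b r j (2 * m) = 1" for j
      using 2 by (rule mathieu_b_even)
    have pos: "?a > 0" "1 + ?u > 0" "1 + ?v > 0"
      using mathieu_a_pos[of r "2 * m"] nonneg[of "2 * m + 1"] assms 2
      by (simp_all add: add_pos_nonneg)
    have "riccati_even r m (real k) (f k (2 * m) (Suc N)) (f (Suc k) (2 * m) (Suc N))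
        = ?a * riccati_odd r m (real k) ?u ?v / ((1 + ?u) * (1 + ?v))"
      using riccati_even_step[of m ?u ?v r "real k"] 2 pos
      by (simp add: f_def b)
    moreover have "?a * ((-1) ^ N * riccati_odd r m (real k) ?u ?v)
        / ((1 + ?u) * (1 + ?v)) > 0"
      using pos Suc(1)[of m]
      by (intro divide_pos_pos mult_pos_pos[of ?a] mult_pos_pos[of "1 + ?u"])
    ultimately show ?case
      by (simp add: algebra_simps)
  }
qed

lemma cfrac_telescoping_sign:
  fixes k N :: nat
  assumes "r \<noteq> 0" "k \<ge> 1"
  defines "F \<equiv> \<lambda>k. cfrac (mathieu_a r) (mathieu_b r k) N"
  shows "(-1) ^ N * (2 * real k / ((real k)\<^sup>2 + r\<^sup>2)\<^sup>2 - (F k - F (Suc k))) > 0"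
proof -
  let ?y = "((real k)\<^sup>2 + r\<^sup>2)\<^sup>2"
  have y: "?y > 0"
    using assms by (simp add: add_pos_nonneg)
  have "0 < (-1) ^ N * riccati_odd r 0 (real k) (F k) (F (Suc k))"
    using riccati_cfrac_sign(1)[of r k N 0] assms by (simp add: F_def cfrac_def)
  \<comment> \<open>At \<open>m = 0\<close> no level has been substituted yet, so the form is the
    telescoping error itself, scaled by \<open>?y\<close>.\<close>
  also have "riccati_odd r 0 (real k) (F k) (F (Suc k)) = 2 * real k - ?y * (F k - F (Suc k))"
    by (simp add: riccati_odd_def mathieu_a_def algebra_simps)
  also have "\<dots> = ?y * (2 * real k / ?y - (F k - F (Suc k)))"
    using y by (simp add: right_diff_distrib)
  finally show ?thesis
    using y by (simp add: zero_less_mult_iff mult.left_commute[of _ ?y])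
qed

section \<open>Summing the telescoping inequality\<close>

text \<open>For \<open>N > 0\<close> the first denominator is at least \<open>k * (k - 1)\<close>
  and the tail below it is nonnegative, so the convergent is squeezed between 0 and
  \<open>1 / (k - 1)\<close>.\<close>

lemma cfrac_mathieu_tendsto_0:
  assumes "r \<noteq> 0"
  shows "(\<lambda>k. cfrac (mathieu_a r) (mathieu_b r k) N) \<longlonglongrightarrow> 0"
proof (cases N)
  case 0
  then show ?thesis by (simp add: cfrac_def)
next
  case (Suc M)
  have le: "cfrac (mathieu_a r) (mathieu_b r k) N \<le> 1 / (real k - 1)" if "k \<ge> 2" for k
  proof -
    let ?t = "cfrac_from (mathieu_a r) (mathieu_b r k) (Suc 1) M"
    have "real k - 1 \<le> real k * (real k - 1)"
      using that mult_right_mono[of 1 "real k" "real k - 1"] by simp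
    also have "\<dots> \<le> mathieu_b r k 1"
      by (simp add: mathieu_b_def Let_def power2_eq_square algebra_simps)
    also have "\<dots> \<le> mathieu_b r k 1 + ?t"
      using mathieu_cfrac_from_nonneg[of r k "Suc 1" M] assms that by simp
    finally show ?thesis
      using that Suc mathieu_a_1[of r] by (simp add: cfrac_def frac_le)
  qed
  have "(\<lambda>k. 1 / (real k - 1)) \<longlonglongrightarrow> 0"
    by real_asymp
  then show ?thesis
  proof (rule tendsto_sandwich[rotated 3])
    show "\<forall>\<^sub>F k in sequentially. 0 \<le> cfrac (mathieu_a r) (mathieu_b r k) N"
      using mathieu_cfrac_from_nonneg[of r _ 1 N] assms
      by (auto simp: eventually_sequentially cfrac_def)
    show "\<forall>\<^sub>F k in sequentially. cfrac (mathieu_a r) (mathieu_b r k) N \<le> 1 / (real k - 1)"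
      using le by (auto simp: eventually_sequentially)
  qed simp
qed

lemma strictly_decreasing_above_limit:
  fixes X :: "nat \<Rightarrow> real"
  assumes "X \<longlonglongrightarrow> L" "\<And>k. k \<ge> 1 \<Longrightarrow> X (Suc k) < X k" "k \<ge> 1"
  shows "L < X k"
proof -
  \<comment> \<open>The weak bound is taken from index \<open>k + 1\<close> on; the step from
    \<open>k\<close> to \<open>k + 1\<close> then supplies strictness.\<close>
  have "decseq (\<lambda>i. X (i + Suc k))"
    using assms(2,3) by (intro decseq_SucI less_imp_le) simp
  moreover have "(\<lambda>i. X (i + Suc k)) \<longlonglongrightarrow> L"
    using assms(1) by (rule LIMSEQ_ignore_initial_segment)
  ultimately have "L \<le> X (0 + Suc k)"
    by (rule decseq_ge)
  with assms(2)[OF assms(3)] show ?thesis by simp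
qed

lemma mathieu_series_cfrac_sign:
  assumes "r \<noteq> 0" "k \<ge> 1"
  shows "(-1) ^ N * (mathieu_series r - ((\<Sum>m=1..<k. 2 * real m / ((real m)\<^sup>2 + r\<^sup>2)\<^sup>2)
          + cfrac (mathieu_a r) (mathieu_b r k) N)) > 0"
proof -
  define g where "g = (\<lambda>m. 2 * real m / ((real m)\<^sup>2 + r\<^sup>2)\<^sup>2)"
  define F where "F = (\<lambda>k. cfrac (mathieu_a r) (mathieu_b r k) N)"
  \<comment> \<open>The sign makes \<open>X\<close> decreasing for either parity of
    \<open>N\<close>: \<open>X j - X (j + 1)\<close> is the quantity shown positive in
    \<open>cfrac_telescoping_sign\<close>.\<close>
  define X where "X = (\<lambda>k. - ((-1) ^ N) * (sum g {1..<k} + F k))"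
  have "(\<lambda>n. \<Sum>m<n. g (Suc m)) \<longlonglongrightarrow> mathieu_series r"
    using summable_LIMSEQ[OF summable_mathieu_series[of r]]
    by (simp add: g_def mathieu_series_def)
  moreover have "(\<Sum>m<n. g (Suc m)) = sum g {1..<Suc n}" for n
    using sum.shift_bounds_Suc_ivl[of g 0 n] by (simp add: lessThan_atLeast0)
  ultimately have "(\<lambda>n. sum g {1..<n}) \<longlonglongrightarrow> mathieu_series r"
    by (simp add: LIMSEQ_imp_Suc)
  from tendsto_add[OF this cfrac_mathieu_tendsto_0[OF assms(1), of N]]
  have "X \<longlonglongrightarrow> - ((-1) ^ N) * mathieu_series r"
    unfolding X_def F_def by (intro tendsto_mult tendsto_const) simp
  moreover have "X (Suc j) < X j" if "j \<ge> 1" for j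
    using cfrac_telescoping_sign[OF assms(1) that, of N] that
    by (simp add: X_def F_def g_def algebra_simps)
  ultimately have "- ((-1) ^ N) * mathieu_series r < X k"
    using assms(2) by (rule strictly_decreasing_above_limit)
  then show ?thesis
    by (simp add: X_def F_def g_def algebra_simps)
qed

theorem theorem2:
  shows "(\<forall>(r::real) (k::nat) (l::nat). r > 0 \<and> k \<ge> 1 \<and> l \<ge> 1 \<longrightarrow>
      (\<Sum>m=1..<k. 2 * real m / ((real m)\<^sup>2 + r\<^sup>2)\<^sup>2)
          + cfrac (mathieu_a r) (mathieu_b r k) (2 * l) < mathieu_series r
      \<and> mathieu_series r < (\<Sum>m=1..<k. 2 * real m / ((real m)\<^sup>2 + r\<^sup>2)\<^sup>2)
          + cfrac (mathieu_a r) (mathieu_b r k) (2 * l - 1))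
    \<and> (\<forall>r::real. r > 0 \<longrightarrow>
      2 / (1 + r\<^sup>2)\<^sup>2 + 1 / (5/2 + r\<^sup>2) < mathieu_series r
      \<and> mathieu_series r < 2 / (1 + r\<^sup>2)\<^sup>2 + 1 / (2 + r\<^sup>2))
    \<and> (\<forall>r::real. r > 0 \<longrightarrow>
      2 / (1 + r\<^sup>2)\<^sup>2 + 4 / (4 + r\<^sup>2)\<^sup>2 + 1 / (13/2 + r\<^sup>2) < mathieu_series r
      \<and> mathieu_series r < 2 / (1 + r\<^sup>2)\<^sup>2 + 4 / (4 + r\<^sup>2)\<^sup>2 + 1 / (6 + r\<^sup>2))"
proof (intro conjI allI impI; (elim conjE)?)
  fix r :: real and k l :: nat
  assume "r > 0" "k \<ge> 1" "l \<ge> 1"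
  then show "(\<Sum>m=1..<k. 2 * real m / ((real m)\<^sup>2 + r\<^sup>2)\<^sup>2)
      + cfrac (mathieu_a r) (mathieu_b r k) (2 * l) < mathieu_series r"
    using mathieu_series_cfrac_sign[of r k "2 * l"] by simp
  \<comment> \<open>Subtraction on naturals is truncated, so oddness depends on
    \<open>l \<ge> 1\<close>.\<close>
  from \<open>l \<ge> 1\<close> have "odd (2 * l - 1)" by simp
  then have "(-1 :: real) ^ (2 * l - 1) = -1" by (rule neg_one_odd_power)
  with \<open>r > 0\<close> \<open>k \<ge> 1\<close> show "mathieu_series r < (\<Sum>m=1..<k. 2 * real m / ((real m)\<^sup>2 + r\<^sup>2)\<^sup>2)
      + cfrac (mathieu_a r) (mathieu_b r k) (2 * l - 1)"
    using mathieu_series_cfrac_sign[of r k "2 * l - 1"] by simp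
next
  fix r :: real
  assume r: "r > 0"
  \<comment> \<open>The explicit bounds are the first two convergents at \<open>k = 2\<close> and
    \<open>k = 3\<close>, where \<open>k * (k - 1)\<close> is 2 and 6; the second numerator 1/2
    turns these into 5/2 and 13/2.\<close>
  have one: "cfrac (mathieu_a r) (mathieu_b r k) 1 = 1 / (real k * (real k - 1) + r\<^sup>2)" for k
    by (simp add: cfrac_def mathieu_a_def mathieu_b_def Let_def power2_eq_square algebra_simps)
  have two: "cfrac (mathieu_a r) (mathieu_b r k) 2 = 1 / (real k * (real k - 1) + 1/2 + r\<^sup>2)" for k
    by (simp add: cfrac_def numeral_2_eq_2 mathieu_a_def mathieu_b_def Let_def)
       (simp add: power2_eq_square algebra_simps)
  note bounds = mathieu_series_cfrac_sign[of r _ 1, unfolded one]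
    mathieu_series_cfrac_sign[of r _ 2, unfolded two]
  show "2 / (1 + r\<^sup>2)\<^sup>2 + 1 / (5/2 + r\<^sup>2) < mathieu_series r"
    and "mathieu_series r < 2 / (1 + r\<^sup>2)\<^sup>2 + 1 / (2 + r\<^sup>2)"
    using bounds[of 2] r by (simp_all add: numeral_2_eq_2)
  show "2 / (1 + r\<^sup>2)\<^sup>2 + 4 / (4 + r\<^sup>2)\<^sup>2 + 1 / (13/2 + r\<^sup>2) < mathieu_series r"
    and "mathieu_series r < 2 / (1 + r\<^sup>2)\<^sup>2 + 4 / (4 + r\<^sup>2)\<^sup>2 + 1 / (6 + r\<^sup>2)"
    using bounds[of 3] r by (simp_all add: eval_nat_numeral)
qed

end
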